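(* Let $D$ be an AGCD domain. Then $D[[X]]$ is integrally closed if and only if $D$ is a completely integrally closed PVMD with torsion $t$-class group. Likewise, $D[[X]]$ is completely integrally closed if and only if $D$ is a completely integrally closed PVMD with torsion $t$-class group.
   Context: $D$ is an integral domain with quotient field $K$. $D$ is an almost GCD (AGCD) domain if for all nonzero $a,b\in D$ there is an integer $n\ge1$ such that $(a^n)\cap(b^n)$ is principal. For a nonzero fractional ideal $I$ put $I^{-1}=\{x\in K\mid xI\subseteq D\}$, $I_v=(I^{-1})^{-1}$, and $I_t=\bigcup\{J_v\mid J\subseteq I,\ J \text{ a nonzero finitely generated fractional ideal}\}$. $I$ is a $t$-ideal if $I_t=I$, and $t$-invertible if $(II^{-1})_t=D$. $D$ is a PVMD (Prüfer $v$-multiplication domain) if every nonzero finitely generated ideal of $D$ is $t$-invertible. The $t$-class group $Cl_t(D)$ is the group of $t$-invertible fractional $t$-ideals under $I\ast J=(IJ)_t$ modulo its subgroup of nonzero principal fractional ideals. An integral domain $R$ with quotient field $L$ is completely integrally closed if whenever $x\in L$ and $0\ne r\in R$ satisfy $rx^n\in R$ for every integer $n\ge1$, then $x\in R$. *)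

theory Defs
  imports
    "HOL-Computational_Algebra.Polynomial_Factorial"
    "HOL-Computational_Algebra.Formal_Power_Series"
    "HOL-Algebra.Coset"
begin

(* The integral domain D is the whole type 'a :: idom, its quotient field K is 'a fract, and
   D sits inside K as range to_fract.  The power series ring D[[X]] is the domain 'a fps, with
   quotient field 'a fps fract. *)

definition frac_scale :: "'a::idom \<Rightarrow> 'a fract \<Rightarrow> 'a fract"
  where "frac_scale r x = to_fract r * x"

(* K as a D-module; frac.subspace and frac.span are "D-submodule" and "D-submodule generated by". *)
global_interpretation frac: module "frac_scale :: 'a::idom \<Rightarrow> 'a fract \<Rightarrow> 'a fract"
  by standard (simp_all add: frac_scale_def algebra_simps)

definition integral_over :: "'a::idom fract \<Rightarrow> bool"
  where "integral_over x \<longleftrightarrow>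
    (\<exists>p :: 'a poly. lead_coeff p = 1 \<and> poly (map_poly to_fract p) x = 0)"

definition integrally_closed :: "'a::idom itself \<Rightarrow> bool"
  where "integrally_closed _ \<longleftrightarrow>
    (\<forall>x :: 'a fract. integral_over x \<longrightarrow> x \<in> range to_fract)"

definition completely_integrally_closed :: "'a::idom itself \<Rightarrow> bool"
  where "completely_integrally_closed _ \<longleftrightarrow>
    (\<forall>(x :: 'a fract) r. r \<noteq> 0 \<and> (\<forall>n\<ge>1. to_fract r * x ^ n \<in> range to_fract)
        \<longrightarrow> x \<in> range to_fract)"

definition ideal_of :: "'a::comm_ring_1 \<Rightarrow> 'a set"
  where "ideal_of a = {a * r | r. True}"

definition agcd_domain :: "'a::idom itself \<Rightarrow> bool"
  where "agcd_domain _ \<longleftrightarrow>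
    (\<forall>(a::'a) b. a \<noteq> 0 \<and> b \<noteq> 0 \<longrightarrow>
       (\<exists>n\<ge>1. \<exists>c. ideal_of (a ^ n) \<inter> ideal_of (b ^ n) = ideal_of c))"

(* {0} is excluded, so every fractional ideal below is nonzero. *)
definition fractional_ideal :: "'a::idom fract set \<Rightarrow> bool"
  where "fractional_ideal I \<longleftrightarrow> frac.subspace I \<and> I \<noteq> {0} \<and>
    (\<exists>d :: 'a. d \<noteq> 0 \<and> (\<forall>x\<in>I. to_fract d * x \<in> range to_fract))"

definition fin_gen :: "'a::idom fract set \<Rightarrow> bool"
  where "fin_gen I \<longleftrightarrow> (\<exists>S. finite S \<and> I = frac.span S)"

definition ideal_prod :: "'a::idom fract set \<Rightarrow> 'a fract set \<Rightarrow> 'a fract set"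
  where "ideal_prod I J = frac.span {x * y | x y. x \<in> I \<and> y \<in> J}"

definition ideal_inv :: "'a::idom fract set \<Rightarrow> 'a fract set"
  where "ideal_inv I = {x. \<forall>y\<in>I. x * y \<in> range to_fract}"

definition v_closure :: "'a::idom fract set \<Rightarrow> 'a fract set"
  where "v_closure I = ideal_inv (ideal_inv I)"

definition t_closure :: "'a::idom fract set \<Rightarrow> 'a fract set"
  where "t_closure I = \<Union> {v_closure J | J. J \<subseteq> I \<and> fractional_ideal J \<and> fin_gen J}"

definition t_ideal :: "'a::idom fract set \<Rightarrow> bool"
  where "t_ideal I \<longleftrightarrow> fractional_ideal I \<and> t_closure I = I"

definition t_invertible :: "'a::idom fract set \<Rightarrow> bool"
  where "t_invertible I \<longleftrightarrow>
    fractional_ideal I \<and> t_closure (ideal_prod I (ideal_inv I)) = range to_fract"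

definition pvmd :: "'a::idom itself \<Rightarrow> bool"
  where "pvmd _ \<longleftrightarrow>
    (\<forall>I :: 'a fract set. fractional_ideal I \<and> I \<subseteq> range to_fract \<and> fin_gen I
        \<longrightarrow> t_invertible I)"

(* The identity is D itself; Mod below is the quotient group of cosets. *)
definition t_inv_ideals :: "'a::idom itself \<Rightarrow> 'a fract set monoid"
  where "t_inv_ideals _ =
    \<lparr>carrier = {I. t_ideal I \<and> t_invertible I},
     mult = \<lambda>I J. t_closure (ideal_prod I J),
     one = range to_fract\<rparr>"

definition principal_fractional_ideals :: "'a::idom itself \<Rightarrow> 'a fract set set"
  where "principal_fractional_ideals _ = {frac.span {x} | x. x \<noteq> 0}"

definition t_class_group :: "'a::idom itself \<Rightarrow> 'a fract set set monoid"
  where "t_class_group D = t_inv_ideals D Mod principal_fractional_ideals D"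

definition torsion_group :: "('g, 'm) monoid_scheme \<Rightarrow> bool"
  where "torsion_group G \<longleftrightarrow>
    (\<forall>x\<in>carrier G. \<exists>n::nat. n \<ge> 1 \<and> x [^]\<^bsub>G\<^esub> n = \<one>\<^bsub>G\<^esub>)"

end

theory Submission
  imports Defs
begin

text \<open>
  Over \<open>D[[X]]\<close>, the equation \<open>Y\<^sup>2 + a Y + X = 0\<close> has a root whose coefficients have unbounded
  powers of \<open>a\<close> as denominators; so if \<open>D[[X]]\<close> is integrally closed, then no nonzero element of
  \<open>D\<close> is divisible by all powers of a nonunit.  For \<open>x\<close> in the quotient field, the AGCD property
  gives \<open>n\<close> and \<open>d\<close> with \<open>(x\<^sup>n, 1)\<^sub>v = (d)\<close>, and also \<open>(x\<^sup>n\<^sup>k, 1)\<^sub>v = (d\<^sup>k)\<close> for all \<open>k\<close>; if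
  \<open>x\<close> is almost integral then \<open>1 / d\<close> is a unit, so \<open>x\<^sup>n\<close> and hence \<open>x\<close> lies in \<open>D\<close>.
  Conversely, if \<open>D\<close> is completely integrally closed then so is \<open>D[[X]]\<close>, by peeling off one
  coefficient at a time.

  The two remaining conditions on \<open>D\<close> are automatic: for finitely many \<open>a\<^sub>i\<close> there are \<open>n\<close>, \<open>d\<close> with
  \<open>(a\<^sub>1\<^sup>n, \<dots>, a\<^sub>k\<^sup>n)\<^sub>v = (d)\<close>, and every product of \<open>n\<close> of the \<open>a\<^sub>i\<close> is divisible by \<open>d\<close> because its
  \<open>n\<close>-th power is divisible by \<open>d\<^sup>n\<close> and \<open>D\<close> is closed under roots.  Hence the \<open>t\<close>-power \<open>I\<^sup>n\<close> of
  \<open>I = (a\<^sub>1, \<dots>, a\<^sub>k)\<close> is \<open>(d)\<close>.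
\<close>

section \<open>The domain inside its quotient field\<close>

abbreviation int_elems :: "'a::idom fract set"
  where "int_elems \<equiv> range to_fract"

lemma int_elems_simps [simp]:
  "0 \<in> int_elems" "1 \<in> int_elems"
  using range_eqI[of 0 to_fract 0] range_eqI[of 1 to_fract 1] by simp_all

lemma int_elems_add: "x \<in> int_elems \<Longrightarrow> y \<in> int_elems \<Longrightarrow> x + y \<in> int_elems"
  by (auto simp flip: to_fract_add)

lemma int_elems_mult: "x \<in> int_elems \<Longrightarrow> y \<in> int_elems \<Longrightarrow> x * y \<in> int_elems"
  by (auto simp flip: to_fract_mult)

lemma int_elems_uminus: "x \<in> int_elems \<Longrightarrow> - x \<in> int_elems"
  by (auto simp flip: to_fract_uminus)

lemma int_elems_sum: "(\<And>i. i \<in> A \<Longrightarrow> f i \<in> int_elems) \<Longrightarrow> sum f A \<in> int_elems"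
  by (induction A rule: infinite_finite_induct) (simp_all add: int_elems_add)

lemma int_elems_power: "x \<in> int_elems \<Longrightarrow> x ^ n \<in> int_elems"
  by (induction n) (simp_all add: int_elems_mult)

lemma to_fract_power [simp]: "to_fract (a ^ n) = to_fract a ^ n"
  by (induction n) simp_all

lemma fract_denominator:
  fixes x :: "'a::idom fract"
  obtains a b where "b \<noteq> 0" "x = to_fract a / to_fract b"
  by (cases x) (auto simp: Fract_conv_to_fract intro: that)

lemma common_denominator:
  fixes S :: "'a::idom fract set"
  assumes "finite S"
  obtains q where "q \<noteq> 0" "\<And>x. x \<in> S \<Longrightarrow> to_fract q * x \<in> int_elems"
  using assms
proof (induction S arbitrary: thesis rule: finite_induct)
  case empty
  show ?case by (rule empty[of 1]) auto
next
  case (insert x S)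
  obtain q where q: "q \<noteq> 0" "\<And>x. x \<in> S \<Longrightarrow> to_fract q * x \<in> int_elems"
    using insert.IH by blast
  obtain a b where ab: "b \<noteq> 0" "x = to_fract a / to_fract b" by (rule fract_denominator)
  show ?case
  proof (rule insert.prems[of "b * q"])
    show "b * q \<noteq> 0" using ab q by simp
    fix y assume "y \<in> insert x S"
    then consider "y = x" | "y \<in> S" by blast
    then show "to_fract (b * q) * y \<in> int_elems"
    proof cases
      case 1
      then have "to_fract (b * q) * y = to_fract (q * a)" using ab by simp
      then show ?thesis by blast
    next
      case 2
      then show ?thesis using int_elems_mult[OF rangeI q(2)[OF 2], of b]
        by (simp add: mult.assoc)
    qed
  qed
qed

section \<open>Integral and complete integral closure\<close>

lemma integrally_closed_root:
  assumes "integrally_closed TYPE('a::idom)" "(x :: 'a fract) ^ n \<in> int_elems" "n \<ge> 1"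
  shows "x \<in> int_elems"
proof -
  obtain e where e: "x ^ n = to_fract e" using assms(2) by blast
  let ?p = "monom 1 n + [:- e:]"
  have "degree [:- e:] < degree (monom (1::'a) n)" using assms(3) by (simp add: degree_monom_eq)
  then have deg: "degree ?p = n" by (simp add: degree_add_eq_left degree_monom_eq)
  have lead: "lead_coeff ?p = 1"
    using assms(3) unfolding deg by (simp add: coeff_eq_0)
  have "map_poly to_fract ?p = monom 1 n + [:- to_fract e:]"
    by (rule poly_eqI) (simp add: coeff_map_poly coeff_pCons split: nat.splits)
  then have "poly (map_poly to_fract ?p) x = 0" by (simp add: poly_monom e)
  with lead have "integral_over x" unfolding integral_over_def by blast
  then show ?thesis using assms(1) unfolding integrally_closed_def by blast
qed

text \<open>If x = a / b is a root of a monic polynomial of degree m, then \<open>b ^ m\<close>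
  clears the denominators of the powers of x below m. The monic equation expresses each higher power
  through lower ones, so the same multiplier works for all of them.\<close>

lemma completely_integrally_closed_imp_integrally_closed:
  assumes "completely_integrally_closed TYPE('a::idom)"
  shows "integrally_closed TYPE('a)"
  unfolding integrally_closed_def
proof (intro allI impI)
  fix x :: "'a fract"
  assume "integral_over x"
  then obtain p :: "'a poly" where p: "lead_coeff p = 1" "poly (map_poly to_fract p) x = 0"
    unfolding integral_over_def by blast
  obtain a b where ab: "b \<noteq> 0" "x = to_fract a / to_fract b" by (rule fract_denominator)
  define m where "m = degree p"
  have deg: "degree (map_poly (to_fract :: 'a \<Rightarrow> _) p) = m"
    unfolding m_def by (rule degree_map_poly) simp
  have "(\<Sum>i\<le>m. to_fract (coeff p i) * x ^ i) = 0"
    using p(2) by (simp add: poly_altdef deg coeff_map_poly)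
  then have xm: "x ^ m = - (\<Sum>i<m. to_fract (coeff p i) * x ^ i)"
    using p(1) by (simp add: lessThan_Suc_atMost[symmetric] m_def[symmetric] eq_neg_iff_add_eq_0 add.commute)
  have "to_fract (b ^ m) * x ^ k \<in> int_elems" for k
  proof (induction k rule: less_induct)
    case (less k)
    show ?case
    proof (cases "k < m")
      case True
      then have "to_fract (b ^ m) * x ^ k = to_fract (b ^ (m - k) * a ^ k)"
        using ab by (simp add: power_divide power_diff)
      then show ?thesis by blast
    next
      case False
      then have "x ^ k = x ^ (k - m) * x ^ m" by (simp flip: power_add)
      then have "to_fract (b ^ m) * x ^ k =
        - (\<Sum>i<m. to_fract (coeff p i) * (to_fract (b ^ m) * x ^ (k - m + i)))"
        by (simp add: xm sum_distrib_left power_add algebra_simps)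
      also have "\<dots> \<in> int_elems"
        using False by (intro int_elems_uminus int_elems_sum int_elems_mult[OF rangeI] less) auto
      finally show ?thesis .
    qed
  qed
  then show "x \<in> int_elems"
    using assms ab(1) unfolding completely_integrally_closed_def by (metis power_not_zero)
qed

section \<open>Power series\<close>

text \<open>When one series divides another over K, the quotient has coefficients in K[[X]] that can
  be examined one by one; an element of \<open>'a fps fract\<close> offers no such access.\<close>

definition fps_to_fract :: "'a::idom fps \<Rightarrow> 'a fract fps"
  where "fps_to_fract f = Abs_fps (\<lambda>n. to_fract (fps_nth f n))"

lemma fps_to_fract_nth [simp]: "fps_nth (fps_to_fract f) n = to_fract (fps_nth f n)"
  by (simp add: fps_to_fract_def)

lemma fps_to_fract_mult: "fps_to_fract (f * g) = fps_to_fract f * fps_to_fract g"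
  by (simp add: fps_eq_iff fps_mult_nth)

lemma fps_to_fract_power: "fps_to_fract (f ^ n) = fps_to_fract f ^ n"
  by (induction n) (simp_all add: fps_to_fract_mult, simp add: fps_eq_iff)

lemma fps_to_fract_inject [simp]: "fps_to_fract f = fps_to_fract g \<longleftrightarrow> f = g"
  by (simp add: fps_eq_iff)

lemma fps_to_fract_eq_0_iff [simp]: "fps_to_fract f = 0 \<longleftrightarrow> f = 0"
  by (simp add: fps_eq_iff)

lemma range_fps_to_fract_iff: "y \<in> range fps_to_fract \<longleftrightarrow> (\<forall>n. fps_nth y n \<in> int_elems)"
proof
  assume "\<forall>n. fps_nth y n \<in> int_elems"
  then have "\<forall>n. \<exists>c. fps_nth y n = to_fract c" by blast
  then obtain q where "\<forall>n. fps_nth y n = to_fract (q n)" unfolding choice_iff by blast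
  then have "y = fps_to_fract (Abs_fps q)" by (simp add: fps_eq_iff)
  then show "y \<in> range fps_to_fract" by blast
qed auto

lemma range_fps_to_fract_mult:
  "x \<in> range fps_to_fract \<Longrightarrow> y \<in> range fps_to_fract \<Longrightarrow> x * y \<in> range fps_to_fract"
  by (auto simp flip: fps_to_fract_mult)

lemma range_fps_to_fract_sum:
  "(\<And>i. i \<in> A \<Longrightarrow> f i \<in> range fps_to_fract) \<Longrightarrow> sum f A \<in> range fps_to_fract"
  by (simp add: range_fps_to_fract_iff fps_sum_nth int_elems_sum)

lemma subdegree_fps_to_fract [simp]: "subdegree (fps_to_fract f) = subdegree f"
proof (cases "f = 0")
  case False
  then show ?thesis by (intro subdegreeI) (auto simp: nth_less_subdegree_zero)
next
  case True
  then have "fps_to_fract f = 0" by simp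
  with True show ?thesis by (simp only: subdegree_0)
qed

text \<open>At the order s of \<open>r\<close>, the coefficient of r y^n is r_s y_0^n, so the
  nonzero r_s shows that y_0 is almost integral over D.\<close>

lemma almost_integral_fps_nth_0:
  fixes y :: "'a::idom fract fps"
  assumes cic: "completely_integrally_closed TYPE('a)" and "r \<noteq> 0"
    and y: "\<And>n. fps_to_fract r * y ^ n \<in> range fps_to_fract"
  shows "fps_nth y 0 \<in> int_elems"
proof -
  let ?s = "subdegree r"
  have "to_fract (fps_nth r ?s) * fps_nth y 0 ^ n \<in> int_elems" for n
  proof -
    have "fps_nth (fps_to_fract r * y ^ n) ?s
        = (\<Sum>i=0..?s. to_fract (fps_nth r i) * fps_nth (y ^ n) (?s - i))"
      by (simp only: fps_mult_nth fps_to_fract_nth)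
    also have "\<dots> = (\<Sum>i\<in>{?s}. to_fract (fps_nth r i) * fps_nth (y ^ n) (?s - i))"
    proof (rule sum.mono_neutral_right)
      show "\<forall>i\<in>{0..?s} - {?s}. to_fract (fps_nth r i) * fps_nth (y ^ n) (?s - i) = 0"
      proof
        fix i assume "i \<in> {0..?s} - {?s}"
        then have "fps_nth r i = 0" by (intro nth_less_subdegree_zero) auto
        then show "to_fract (fps_nth r i) * fps_nth (y ^ n) (?s - i) = 0"
          by (simp only: to_fract_0 mult_zero_left)
      qed
    qed simp_all
    finally have eq: "fps_nth (fps_to_fract r * y ^ n) ?s = to_fract (fps_nth r ?s) * fps_nth y 0 ^ n"
      by (simp add: fps_power_zeroth)
    have "fps_nth (fps_to_fract r * y ^ n) ?s \<in> int_elems"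
      using y[of n] unfolding range_fps_to_fract_iff by blast
    then show ?thesis unfolding eq .
  qed
  then show ?thesis
    using cic \<open>r \<noteq> 0\<close> unfolding completely_integrally_closed_def by (metis nth_subdegree_nonzero)
qed

text \<open>Once y_0 is known to lie in D, subtract it and divide by X. The result satisfies the
  same hypothesis with the same \<open>r\<close>, and its coefficients are those of y shifted by
  one.\<close>

lemma almost_integral_fps_nth:
  fixes y :: "'a::idom fract fps"
  assumes cic: "completely_integrally_closed TYPE('a)" and "r \<noteq> 0"
    and "\<And>n. fps_to_fract r * y ^ n \<in> range fps_to_fract"
  shows "fps_nth y i \<in> int_elems"
  using assms(3)
proof (induction i arbitrary: y)
  case 0
  then show ?case using almost_integral_fps_nth_0[OF cic \<open>r \<noteq> 0\<close>] by blast
next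
  case (Suc i)
  obtain c where c: "fps_nth y 0 = to_fract c"
    using almost_integral_fps_nth_0[OF cic \<open>r \<noteq> 0\<close> Suc.prems] by blast
  define z where "z = fps_shift 1 y"
  \<comment> \<open>The difference is written as a sum with \<open>- c\<close> so that
    \<open>binomial_ring\<close> expands its n-th power; each term is some r y^k times a multiplier
    from D[[X]].\<close>
  have z: "y + fps_to_fract (fps_const (- c)) = fps_X * z"
  proof (rule fps_ext)
    fix n show "fps_nth (y + fps_to_fract (fps_const (- c))) n = fps_nth (fps_X * z) n"
      by (cases n) (simp_all add: z_def c)
  qed
  have "fps_to_fract r * z ^ n \<in> range fps_to_fract" for n
  proof -
    have "fps_to_fract r * (fps_X * z) ^ n = (\<Sum>k\<le>n. fps_to_fract (of_nat (n choose k)) *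
        (fps_to_fract r * y ^ k) * fps_to_fract (fps_const (- c) ^ (n - k)))"
      unfolding z[symmetric] binomial_ring sum_distrib_left
    proof (intro sum.cong refl)
      fix k
      have of_nat: "fps_to_fract (of_nat m :: 'a fps) = of_nat m" for m
        by (induction m) (simp_all add: fps_eq_iff)
      then show "fps_to_fract r * (of_nat (n choose k) * y ^ k * fps_to_fract (fps_const (- c)) ^ (n - k)) =
        fps_to_fract (of_nat (n choose k)) * (fps_to_fract r * y ^ k) * fps_to_fract (fps_const (- c) ^ (n - k))"
        unfolding fps_to_fract_power of_nat by (simp only: mult_ac)
    qed
    also have "\<dots> \<in> range fps_to_fract"
      by (intro range_fps_to_fract_sum range_fps_to_fract_mult rangeI Suc.prems)
    also have "fps_to_fract r * (fps_X * z) ^ n = fps_X ^ n * (fps_to_fract r * z ^ n)"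
      by (simp add: power_mult_distrib mult_ac)
    finally have "fps_nth (fps_X ^ n * (fps_to_fract r * z ^ n)) (j + n) \<in> int_elems" for j
      by (simp only: range_fps_to_fract_iff)
    then show ?thesis by (simp add: range_fps_to_fract_iff fps_X_power_mult_nth)
  qed
  from Suc.IH[OF this] show ?case by (simp add: z_def)
qed

text \<open>Comparing orders in r f^n = g^n h_n shows that f / g has no pole, so it is a series y
  over K. Then r y^n = h_n, and \<open>almost_integral_fps_nth\<close> puts the coefficients of y in
  D.\<close>

lemma completely_integrally_closed_fps:
  assumes cic: "completely_integrally_closed TYPE('a::idom)"
  shows "completely_integrally_closed TYPE('a fps)"
  unfolding completely_integrally_closed_def
proof (intro allI impI, elim conjE)
  fix x :: "'a fps fract" and r :: "'a fps"
  assume r: "r \<noteq> 0" and rx: "\<forall>n\<ge>1. to_fract r * x ^ n \<in> range to_fract"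
  obtain f g where fg: "g \<noteq> 0" "x = to_fract f / to_fract g" by (rule fract_denominator)
  have "\<exists>h. r * f ^ n = g ^ n * h" for n
  proof (cases "n \<ge> 1")
    case True
    then obtain h where "to_fract r * x ^ n = to_fract h" using rx by blast
    then have "to_fract (r * f ^ n) = to_fract (g ^ n * h)"
      using fg by (simp add: power_divide field_simps)
    then show ?thesis by (metis to_fract_eq_iff)
  next
    case False
    then show ?thesis by (auto simp: not_less_eq_eq)
  qed
  then obtain h where h: "\<And>n. r * f ^ n = g ^ n * h n" by metis
  have "g dvd f"
  proof (cases "f = 0")
    case False
    have "n * subdegree g \<le> subdegree r + n * subdegree f" for n
    proof -
      have "h n \<noteq> 0" using h[of n] False r by auto
      then have "subdegree (r * f ^ n) = n * subdegree g + subdegree (h n)"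
        using h[of n] fg(1) by simp
      then show ?thesis using r False by simp
    qed
    \<comment> \<open>With an exponent exceeding the order of \<open>r\<close>, a deficit of even 1
      in the order of f would outweigh the contribution of \<open>r\<close>.\<close>
    from this[of "Suc (subdegree r)"] have "subdegree g \<le> subdegree f"
    proof (rule contrapos_pp)
      assume "\<not> subdegree g \<le> subdegree f"
      then have "Suc (subdegree r) * (subdegree f + 1) \<le> Suc (subdegree r) * subdegree g"
        by (intro mult_le_mono2) simp
      then show "\<not> Suc (subdegree r) * subdegree g \<le> subdegree r + Suc (subdegree r) * subdegree f"
        by simp
    qed
    then have "fps_to_fract g dvd fps_to_fract f"
      using False fg(1) by (subst fps_dvd_iff) simp_all
    then obtain y where y: "fps_to_fract f = fps_to_fract g * y" by (elim dvdE)
    have "fps_to_fract r * y ^ n \<in> range fps_to_fract" for n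
    proof -
      have "fps_to_fract g ^ n * (fps_to_fract r * y ^ n) = fps_to_fract (r * f ^ n)"
        by (simp add: fps_to_fract_mult fps_to_fract_power y power_mult_distrib mult_ac)
      also have "\<dots> = fps_to_fract g ^ n * fps_to_fract (h n)"
        by (simp add: h fps_to_fract_mult fps_to_fract_power)
      finally show ?thesis using fg(1) by simp
    qed
    then have "y \<in> range fps_to_fract"
      using almost_integral_fps_nth[OF cic r] by (simp add: range_fps_to_fract_iff)
    then obtain q where "y = fps_to_fract q" by blast
    then have "f = g * q" using y by (simp flip: fps_to_fract_mult)
    then show ?thesis by simp
  qed simp
  then obtain q where "f = g * q" by (elim dvdE)
  then have "x = to_fract q" using fg by simp
  then show "x \<in> range to_fract" by blast
qed

section \<open>Consequences of integral closedness of D[[X]]\<close>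

text \<open>Dividing by the square of \<open>c\<close> makes z / c a root of the monic Y^2 + a Y +
  b. The divisibility form keeps fractions out of the application to power series.\<close>

lemma integrally_closed_quadratic_dvd:
  fixes c z :: "'a::idom"
  assumes "integrally_closed TYPE('a)" "c \<noteq> 0" and eq: "z\<^sup>2 + a * c * z + b * c\<^sup>2 = 0"
  shows "c dvd z"
proof -
  let ?y = "to_fract z / to_fract c"
  let ?p = "[:b, a, 1:]"
  have "map_poly to_fract ?p = [:to_fract b, to_fract a, 1:]"
    by (rule poly_eqI) (simp add: coeff_map_poly coeff_pCons split: nat.splits)
  then have "poly (map_poly to_fract ?p) ?y = to_fract (z\<^sup>2 + a * c * z + b * c\<^sup>2) / to_fract c ^ 2"
    using \<open>c \<noteq> 0\<close> by (simp add: field_simps power2_eq_square)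
  then have "integral_over ?y"
    unfolding integral_over_def eq by (intro exI[of _ ?p]) simp
  then obtain q where "?y = to_fract q"
    using assms(1) unfolding integrally_closed_def by blast
  then have "to_fract z = to_fract (c * q)" using \<open>c \<noteq> 0\<close> by (simp add: field_simps)
  then show ?thesis unfolding to_fract_eq_iff by simp
qed

fun catalan :: "nat \<Rightarrow> nat"
  where "catalan 0 = 1"
  | "catalan (Suc n) = (\<Sum>i\<le>n. catalan i * catalan (n - i))"

text \<open>If \<open>C\<close> is the generating function of the Catalan numbers, then \<open>- (X / a) C(X / a\<^sup>2)\<close>
  is a root of \<open>Y\<^sup>2 + a Y + X\<close>, and \<open>c\<close> clears all its denominators.\<close>

lemma integrally_closed_fps_archimedean:
  fixes a c :: "'a::idom"
  assumes ic: "integrally_closed TYPE('a fps)" and "c \<noteq> 0" and dvd: "\<And>n. a ^ n dvd c"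
  shows "a dvd 1"
proof -
  obtain e where e: "\<And>n. c = a ^ n * e n" using dvd unfolding dvd_def by metis
  have "a \<noteq> 0" using e[of 1] \<open>c \<noteq> 0\<close> by auto
  \<comment> \<open>Since \<open>e n\<close> is c / a^n, the series -X w is \<open>c\<close> times
    the formal root.\<close>
  define w where "w = Abs_fps (\<lambda>k. of_nat (catalan k) * e (2 * k + 1))"
  \<comment> \<open>Both sides are c^2 / a^(2k+2). The left side does not depend on i, so the
    Catalan recursion can be applied to the coefficients of w^2.\<close>
  have ee: "e (2 * i + 1) * e (2 * (k - i) + 1) = a * c * e (2 * Suc k + 1)" if "i \<le> k" for i k
  proof -
    have "a ^ (2 * k + 2) = a ^ (2 * i + 1) * a ^ (2 * (k - i) + 1)"
      using that by (simp flip: power_add add: algebra_simps)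
    then have "a ^ (2 * k + 2) * (e (2 * i + 1) * e (2 * (k - i) + 1))
        = (a ^ (2 * i + 1) * e (2 * i + 1)) * (a ^ (2 * (k - i) + 1) * e (2 * (k - i) + 1))"
      by (simp only: mult_ac)
    also have "\<dots> = c * (a ^ (2 * Suc k + 1) * e (2 * Suc k + 1))" by (simp only: e[symmetric])
    also have "\<dots> = a ^ (2 * k + 2) * (a * c * e (2 * Suc k + 1))"
      by (simp add: mult_ac)
    finally show ?thesis using \<open>a \<noteq> 0\<close> by (metis mult_left_cancel power_not_zero)
  qed
  \<comment> \<open>This is Y^2 + a Y + X = 0 at Y = -X w / c, multiplied by c^2 and divided by
    X.\<close>
  have eq: "fps_X * (w * w) + fps_const (c * c) = fps_const (a * c) * w"
  proof (rule fps_ext)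
    fix n show "fps_nth (fps_X * (w * w) + fps_const (c * c)) n = fps_nth (fps_const (a * c) * w) n"
    proof (cases n)
      case 0
      then show ?thesis using e[of 1] by (simp add: w_def)
    next
      case (Suc k)
      have "fps_nth (w * w) k = (\<Sum>i\<le>k. of_nat (catalan i * catalan (k - i)) *
          (e (2 * i + 1) * e (2 * (k - i) + 1)))"
        by (simp add: fps_mult_nth w_def atLeast0AtMost mult_ac)
      also have "\<dots> = (\<Sum>i\<le>k. of_nat (catalan i * catalan (k - i)) * (a * c * e (2 * Suc k + 1)))"
        using ee by (intro sum.cong) auto
      also have "\<dots> = a * c * (of_nat (catalan (Suc k)) * e (2 * Suc k + 1))"
        by (simp add: sum_distrib_left sum_distrib_right mult_ac)
      finally show ?thesis unfolding Suc by (simp add: w_def)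
    qed
  qed
  let ?z = "- (fps_X * w)"
  have "?z\<^sup>2 + fps_const a * fps_const c * ?z + fps_X * (fps_const c)\<^sup>2
      = fps_X * (fps_X * (w * w) + fps_const (c * c) - fps_const (a * c) * w)"
    by (simp add: power2_eq_square algebra_simps flip: fps_const_mult)
  also have "\<dots> = 0" unfolding eq by simp
  finally have "fps_const c dvd ?z"
    using integrally_closed_quadratic_dvd[OF ic] \<open>c \<noteq> 0\<close> by (metis fps_const_eq_0_iff)
  then obtain q where q: "?z = fps_const c * q" by (elim dvdE)
  \<comment> \<open>The coefficient of X exhibits the inverse of \<open>a\<close>: since c = a e_1,
    cancelling e_1 leaves -1 = a q_1.\<close>
  have "- e 1 = c * fps_nth q 1" using arg_cong[OF q, of "\<lambda>f. fps_nth f 1"] by (simp add: w_def)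
  then have "e 1 = - (a ^ 1 * e 1 * fps_nth q 1)" by (metis e minus_minus)
  then have "e 1 * (a * - fps_nth q 1) = e 1 * 1" by (simp add: mult_ac)
  moreover have "e 1 \<noteq> 0" using e[of 1] \<open>c \<noteq> 0\<close> by auto
  ultimately have "a * - fps_nth q 1 = 1" by (metis mult_left_cancel)
  then show ?thesis by (metis dvd_triv_left)
qed

text \<open>Numerator and denominator are read as constant series. The root found in D[[X]] yields
  one in D through its constant coefficient.\<close>

lemma integrally_closed_fps_root:
  fixes x :: "'a::idom fract"
  assumes ic: "integrally_closed TYPE('a fps)" and "x ^ n \<in> int_elems" "n \<ge> 1"
  shows "x \<in> int_elems"
proof -
  obtain a b where ab: "b \<noteq> 0" "x = to_fract a / to_fract b" by (rule fract_denominator)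
  obtain e where "x ^ n = to_fract e" using assms(2) by blast
  then have "to_fract (a ^ n) = to_fract (b ^ n * e)" using ab by (simp add: power_divide field_simps)
  then have e: "a ^ n = b ^ n * e" by (simp only: to_fract_eq_iff)
  let ?x = "to_fract (fps_const a) / to_fract (fps_const b)"
  have "?x ^ n = to_fract (fps_const (a ^ n)) / to_fract (fps_const b) ^ n"
    by (simp add: power_divide flip: to_fract_power)
  also have "\<dots> = to_fract (fps_const e)"
    using ab(1) by (simp add: e flip: fps_const_mult fps_const_power)
  finally have "?x ^ n \<in> int_elems" by simp
  then obtain q where "?x = to_fract q" using integrally_closed_root[OF ic] assms(3) by blast
  then have "to_fract (fps_const a) = to_fract (fps_const b * q)" using ab(1) by (simp add: field_simps)
  then have "fps_const a = fps_const b * q" by (simp only: to_fract_eq_iff)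
  from arg_cong[OF this, of "\<lambda>f. fps_nth f 0"] have "a = b * fps_nth q 0" by simp
  then have "x = to_fract (fps_nth q 0)" using ab by simp
  then show ?thesis by blast
qed

section \<open>Principal v-closures in almost GCD domains\<close>

text \<open>This expresses (S)_v = (d) in the form S^{-1} = (1/d), directly for a generating set, so
  that proofs reduce to integrality tests on generators.\<close>

definition v_generator :: "'a::idom fract set \<Rightarrow> 'a fract \<Rightarrow> bool"
  where "v_generator S d \<longleftrightarrow> d \<noteq> 0 \<and> (\<forall>z. z \<in> ideal_inv S \<longleftrightarrow> z * d \<in> int_elems)"

lemma ideal_inv_insert: "z \<in> ideal_inv (insert a S) \<longleftrightarrow> z * a \<in> int_elems \<and> z \<in> ideal_inv S"
  by (auto simp: ideal_inv_def)

lemma v_generator_scale: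
  assumes "v_generator S d" "c \<noteq> 0"
  shows "v_generator ((*) c ` S) (c * d)"
proof -
  have "z \<in> ideal_inv ((*) c ` S) \<longleftrightarrow> z * c \<in> ideal_inv S" for z
    by (simp add: ideal_inv_def mult.assoc)
  then show ?thesis using assms by (simp add: v_generator_def mult.assoc)
qed

lemma v_generator_1_subset: "v_generator S 1 \<Longrightarrow> S \<subseteq> int_elems"
  unfolding v_generator_def ideal_inv_def by (auto dest: spec[of _ 1])

lemma v_generator_1I:
  assumes "S \<subseteq> int_elems" "\<And>z. z \<in> ideal_inv S \<Longrightarrow> z \<in> int_elems"
  shows "v_generator S 1"
  using assms by (auto simp: v_generator_def ideal_inv_def intro!: int_elems_mult)

lemma v_generator_1D: "v_generator S 1 \<Longrightarrow> z \<in> ideal_inv S \<Longrightarrow> z \<in> int_elems"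
  by (simp add: v_generator_def)

text \<open>Coprimality to S is multiplicative: if z a b and z S are integral, then so is (z a) S,
  hence z a by the hypothesis on \<open>b\<close>, hence z by the hypothesis on
  \<open>a\<close>.\<close>

lemma v_generator_insert_mult:
  assumes a: "v_generator (insert a S) 1" and b: "v_generator (insert b S) 1"
  shows "v_generator (insert (a * b) S) 1"
proof (rule v_generator_1I)
  have int: "a \<in> int_elems" "b \<in> int_elems" "S \<subseteq> int_elems"
    using v_generator_1_subset[OF a] v_generator_1_subset[OF b] by simp_all
  then show "insert (a * b) S \<subseteq> int_elems" by (simp add: int_elems_mult)
  fix z assume z: "z \<in> ideal_inv (insert (a * b) S)"
  have "a * (z * s) \<in> int_elems" if "s \<in> S" for s
  proof -
    have "z * s \<in> int_elems" using z that by (simp add: ideal_inv_def)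
    then show ?thesis by (rule int_elems_mult[OF int(1)])
  qed
  then have "z * a \<in> ideal_inv S" by (simp add: ideal_inv_def mult_ac)
  moreover have "z * a * b \<in> int_elems" using z by (simp add: ideal_inv_insert mult.assoc)
  ultimately have "z * a \<in> int_elems" using v_generator_1D[OF b] by (simp add: ideal_inv_insert)
  then show "z \<in> int_elems" using v_generator_1D[OF a] z by (simp add: ideal_inv_insert)
qed

lemma v_generator_insert_power:
  assumes "v_generator (insert a S) 1"
  shows "v_generator (insert (a ^ n) S) 1"
proof (induction n)
  case 0
  show ?case
    using v_generator_1_subset[OF assms] by (intro v_generator_1I) (auto simp: ideal_inv_insert)
next
  case (Suc n)
  then show ?case using v_generator_insert_mult[OF assms] by simp
qed

text \<open>The set \<open>S\<close> of unchanged elements varies in the induction: it absorbs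
  \<open>a\<close> while the rest of \<open>T\<close> is raised to powers, and
  \<open>v_generator_insert_power\<close> then treats \<open>a\<close>.\<close>

lemma v_generator_Un_power:
  assumes "finite T" "v_generator (T \<union> S) 1"
  shows "v_generator ((\<lambda>x. x ^ n) ` T \<union> S) 1"
  using assms
proof (induction T arbitrary: S rule: finite_induct)
  case (insert a T)
  have "v_generator (T \<union> insert a S) 1" using insert.prems by simp
  from insert.IH[OF this] show ?case by (simp add: v_generator_insert_power)
qed simp

text \<open>Dividing by \<open>d\<close> reduces this to the coprime case d = 1.\<close>

lemma v_generator_power:
  assumes "finite T" "v_generator T d"
  shows "v_generator ((\<lambda>x. x ^ n) ` T) (d ^ n)"
proof -
  have d: "d \<noteq> 0" using assms(2) by (simp add: v_generator_def)
  then have "v_generator ((*) (inverse d) ` T \<union> {}) 1"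
    using v_generator_scale[OF assms(2), of "inverse d"] by simp
  from v_generator_Un_power[OF _ this, of n]
  have "v_generator ((\<lambda>x. x ^ n) ` (*) (inverse d) ` T) 1" using assms(1) by simp
  from v_generator_scale[OF this, of "d ^ n"] d show ?thesis
    by (simp add: image_image power_mult_distrib power_inverse mult.assoc[symmetric])
qed

lemma v_generator_insert:
  assumes "v_generator S d" "v_generator {a, d} e"
  shows "v_generator (insert a S) e"
  using assms by (auto simp: v_generator_def ideal_inv_insert ideal_inv_def)

text \<open>After clearing denominators, let c generate the intersection of (a^n) and (b^n). The
  generator is the product divided by this least common multiple: z a^n and z b^n are integral iff z
  a^n b^n lies in (c).\<close>

lemma agcd_v_generator_pair:
  fixes x y :: "'a::idom fract"
  assumes agcd: "agcd_domain TYPE('a)" and "x \<noteq> 0" "y \<noteq> 0"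
  shows "\<exists>n\<ge>1. \<exists>d. v_generator {x ^ n, y ^ n} d"
proof -
  obtain q where q: "q \<noteq> 0" "\<And>u. u \<in> {x, y} \<Longrightarrow> to_fract q * u \<in> int_elems"
    using common_denominator[of "{x, y}"] by auto
  obtain a where a: "to_fract q * x = to_fract a" using q(2)[of x] by blast
  obtain b where b: "to_fract q * y = to_fract b" using q(2)[of y] by blast
  have nz: "a \<noteq> 0" "b \<noteq> 0" using a b q(1) assms(2,3) by (metis mult_eq_0_iff to_fract_eq_0_iff)+
  obtain n c where n: "n \<ge> 1" and c: "ideal_of (a ^ n) \<inter> ideal_of (b ^ n) = ideal_of c"
    using agcd nz unfolding agcd_domain_def by blast
  have "a ^ n * b ^ n \<in> ideal_of (a ^ n)" "b ^ n * a ^ n \<in> ideal_of (b ^ n)"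
    unfolding ideal_of_def by blast+
  \<comment> \<open>The nonzero common multiple excludes the generator c = 0.\<close>
  then have "a ^ n * b ^ n \<in> ideal_of c" unfolding c[symmetric] by (simp add: mult.commute)
  then have "c \<noteq> 0" using nz by (auto simp: ideal_of_def)
  define d where "d = to_fract (a ^ n) * to_fract (b ^ n) / to_fract c"
  have "d \<noteq> 0" using nz \<open>c \<noteq> 0\<close> by (simp add: d_def)
  have mem: "u \<in> ideal_of v \<longleftrightarrow> to_fract u / to_fract v \<in> int_elems" if "v \<noteq> 0" for u v :: 'a
  proof -
    have "to_fract u / to_fract v = to_fract r \<longleftrightarrow> to_fract u = to_fract (v * r)" for r
      using that by (simp add: field_simps)
    then show ?thesis unfolding image_iff ideal_of_def by (simp only: to_fract_eq_iff) auto
  qed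
  have "z \<in> ideal_inv {to_fract (a ^ n), to_fract (b ^ n)} \<longleftrightarrow> z * d \<in> int_elems" for z
  proof
    assume z: "z \<in> ideal_inv {to_fract (a ^ n), to_fract (b ^ n)}"
    then have "z * to_fract (a ^ n) \<in> int_elems" by (simp add: ideal_inv_def)
    from int_elems_mult[OF this, of "to_fract (b ^ n)"]
    obtain u where u: "z * to_fract (a ^ n) * to_fract (b ^ n) = to_fract u" by blast
    have "u \<in> ideal_of (a ^ n)" "u \<in> ideal_of (b ^ n)"
      using z nz unfolding ideal_inv_def by (simp_all add: mem flip: u)
    then have "u \<in> ideal_of c" using c by blast
    then show "z * d \<in> int_elems" using \<open>c \<noteq> 0\<close> by (simp add: mem d_def mult.assoc flip: u)
  next
    assume "z * d \<in> int_elems"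
    then obtain r where r: "z * d = to_fract r" by blast
    then have r': "z * to_fract (a ^ n) * to_fract (b ^ n) = to_fract (c * r)"
      using \<open>c \<noteq> 0\<close> by (simp add: d_def field_simps)
    have "c * r \<in> ideal_of c" by (auto simp: ideal_of_def)
    then have "c * r \<in> ideal_of (a ^ n)" "c * r \<in> ideal_of (b ^ n)" using c by blast+
    then show "z \<in> ideal_inv {to_fract (a ^ n), to_fract (b ^ n)}"
      using nz by (simp add: ideal_inv_def mem del: to_fract_mult flip: r')
  qed
  then have "v_generator {to_fract (a ^ n), to_fract (b ^ n)} d"
    using \<open>d \<noteq> 0\<close> by (simp add: v_generator_def)
  from v_generator_scale[OF this, of "inverse (to_fract q ^ n)"]
  have "v_generator {inverse (to_fract q ^ n) * to_fract a ^ n, inverse (to_fract q ^ n) * to_fract b ^ n}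
      (inverse (to_fract q ^ n) * d)" using q(1) by simp
  moreover have "inverse (to_fract q ^ n) * to_fract a ^ n = x ^ n"
    "inverse (to_fract q ^ n) * to_fract b ^ n = y ^ n"
    using q(1) by (simp_all add: power_mult_distrib flip: a b)
  ultimately show ?thesis using n by metis
qed

text \<open>To add x, apply the pair case to x^n and the generator \<open>d\<close> found so far.
  The new exponent m is imposed on the old elements by \<open>v_generator_power\<close>.\<close>

lemma agcd_v_generator_finite:
  fixes S :: "'a::idom fract set"
  assumes agcd: "agcd_domain TYPE('a)" and "finite S" "S \<noteq> {}" "0 \<notin> S"
  shows "\<exists>n\<ge>1. \<exists>d. v_generator ((\<lambda>x. x ^ n) ` S) d"
  using assms(2-4)
proof (induction S rule: finite_ne_induct)
  case (singleton x)
  then have "v_generator ((\<lambda>x. x ^ 1) ` {x}) x" by (simp add: v_generator_def ideal_inv_def)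
  then show ?case by blast
next
  case (insert x S)
  obtain n d where n: "n \<ge> 1" "v_generator ((\<lambda>x. x ^ n) ` S) d" using insert by auto
  have "x ^ n \<noteq> 0" "d \<noteq> 0" using insert.prems n(2) by (auto simp: v_generator_def)
  then obtain m e where m: "m \<ge> 1" "v_generator {(x ^ n) ^ m, d ^ m} e"
    using agcd_v_generator_pair[OF agcd] by blast
  have "v_generator ((\<lambda>x. x ^ m) ` (\<lambda>x. x ^ n) ` S) (d ^ m)"
    using insert.hyps n(2) by (intro v_generator_power) auto
  from v_generator_insert[OF this m(2)]
  have "v_generator ((\<lambda>x. x ^ (n * m)) ` insert x S) e" by (simp add: image_image power_mult)
  moreover have "n * m \<ge> 1" using n(1) m(1) by simp
  ultimately show ?case by blast
qed

lemma integrally_closed_fps_imp_completely_integrally_closed: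
  assumes agcd: "agcd_domain TYPE('a::idom)" and ic: "integrally_closed TYPE('a fps)"
  shows "completely_integrally_closed TYPE('a)"
  unfolding completely_integrally_closed_def
proof (intro allI impI, elim conjE)
  fix x :: "'a fract" and r :: 'a
  assume r: "r \<noteq> 0" and rx: "\<forall>n\<ge>1. to_fract r * x ^ n \<in> int_elems"
  show "x \<in> int_elems"
  proof (cases "x = 0")
    case False
    then obtain n d where n: "n \<ge> 1" and "v_generator {x ^ n, 1 ^ n} d"
      using agcd_v_generator_pair[OF agcd] by (metis zero_neq_one)
    then have d: "v_generator {x ^ n, 1} d" by simp
    then have "d \<noteq> 0" by (simp add: v_generator_def)
    \<comment> \<open>Because 1 belongs to the set, this also makes 1 / d an element of D.\<close>
    have w: "inverse d \<in> ideal_inv {x ^ n, 1}" using d by (simp add: v_generator_def)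
    then obtain w where w': "inverse d = to_fract w" by (auto simp: ideal_inv_def)
    \<comment> \<open>The element \<open>r\<close> clears the denominators of x^(nk) and 1, which
      have v-generator d^k; hence r d^k lies in D. The case k = 0 is separate because
      \<open>rx\<close> starts at exponent 1.\<close>
    have "w ^ k dvd r" for k
    proof -
      have "to_fract r \<in> ideal_inv ((\<lambda>x. x ^ k) ` {x ^ n, 1})"
        using rx[rule_format, of "n * k"] n
        by (cases "k = 0") (auto simp: ideal_inv_def simp flip: power_mult)
      then have "to_fract r * d ^ k \<in> int_elems"
        using v_generator_power[OF _ d, of k] by (simp add: v_generator_def)
      then obtain s where "to_fract r * d ^ k = to_fract s" by blast
      then have "to_fract r = to_fract (w ^ k * s)"
        using \<open>d \<noteq> 0\<close> by (simp flip: w' add: field_simps)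
      then show ?thesis unfolding to_fract_eq_iff by simp
    qed
    from integrally_closed_fps_archimedean[OF ic r this]
    obtain u where "1 = w * u" by (elim dvdE)
    then have "1 = inverse d * to_fract u" unfolding w' by (metis to_fract_1 to_fract_mult)
    then have "d = to_fract u" using \<open>d \<noteq> 0\<close> by (simp add: field_simps)
    then have "x ^ n = to_fract u * (inverse d * x ^ n)" using \<open>d \<noteq> 0\<close> by simp
    moreover have "inverse d * x ^ n \<in> int_elems" using w by (simp add: ideal_inv_def)
    ultimately have "x ^ n \<in> int_elems" by (metis int_elems_mult rangeI)
    then show ?thesis using integrally_closed_fps_root[OF ic] n by blast
  qed simp
qed

section \<open>Fractional ideals\<close>

text \<open>Through \<open>frac.span_minimal\<close>, integrality on a span can thus be tested on
  generators.\<close>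

lemma subspace_mult_int_elems: "frac.subspace {x. z * x \<in> int_elems}"
proof (rule frac.subspaceI)
  fix c :: 'a and x assume "x \<in> {x. z * x \<in> int_elems}"
  then have "to_fract c * (z * x) \<in> int_elems" using int_elems_mult by blast
  then show "frac_scale c x \<in> {x. z * x \<in> int_elems}" by (simp add: frac_scale_def mult_ac)
qed (simp_all add: distrib_left int_elems_add)

lemma ideal_inv_span [simp]: "ideal_inv (frac.span S) = ideal_inv S"
proof
  show "ideal_inv S \<subseteq> ideal_inv (frac.span S)"
  proof
    fix z assume "z \<in> ideal_inv S"
    then have "frac.span S \<subseteq> {x. z * x \<in> int_elems}"
      by (intro frac.span_minimal subspace_mult_int_elems) (auto simp: ideal_inv_def)
    then show "z \<in> ideal_inv (frac.span S)" by (auto simp: ideal_inv_def)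
  qed
  show "ideal_inv (frac.span S) \<subseteq> ideal_inv S"
    by (auto simp: ideal_inv_def frac.span_base)
qed

lemma v_closure_v_generator:
  assumes "v_generator S d"
  shows "x \<in> v_closure (frac.span S) \<longleftrightarrow> x / d \<in> int_elems"
proof
  have d: "d \<noteq> 0" using assms by (simp add: v_generator_def)
  have "inverse d \<in> ideal_inv S" using assms by (simp add: v_generator_def)
  then show "x \<in> v_closure (frac.span S) \<Longrightarrow> x / d \<in> int_elems"
    by (auto simp: v_closure_def ideal_inv_def[of "ideal_inv S"] divide_inverse)
  assume x: "x / d \<in> int_elems"
  have "x * z \<in> int_elems" if "z \<in> ideal_inv S" for z
  proof -
    have "z * d \<in> int_elems" using that assms by (simp add: v_generator_def)
    from int_elems_mult[OF x this] d show ?thesis by (simp add: field_simps)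
  qed
  then show "x \<in> v_closure (frac.span S)"
    by (auto simp: v_closure_def ideal_inv_def[of "ideal_inv S"])
qed

lemma fractional_ideal_span:
  assumes "finite S" "s \<in> S" "s \<noteq> 0"
  shows "fractional_ideal (frac.span S)"
proof -
  obtain q where q: "q \<noteq> 0" "\<And>x. x \<in> S \<Longrightarrow> to_fract q * x \<in> int_elems"
    using common_denominator[OF assms(1)] by blast
  have "frac.span S \<subseteq> {x. to_fract q * x \<in> int_elems}"
    by (rule frac.span_minimal) (use q(2) subspace_mult_int_elems in auto)
  moreover have "s \<in> frac.span S" using assms(2) by (rule frac.span_base)
  ultimately show ?thesis
    using q(1) assms(3) unfolding fractional_ideal_def by (auto simp: frac.subspace_span)
qed

lemma v_closure_subset_t_closure:
  assumes "finite S" "s \<in> S" "s \<noteq> 0" "S \<subseteq> A" "frac.subspace A"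
  shows "v_closure (frac.span S) \<subseteq> t_closure A"
proof -
  have "fin_gen (frac.span S)" using assms(1) unfolding fin_gen_def by blast
  with fractional_ideal_span[OF assms(1-3)] frac.span_minimal[OF assms(4,5)] show ?thesis
    unfolding t_closure_def by (intro Union_upper) blast
qed

lemma subset_v_closure: "A \<subseteq> v_closure A"
  by (auto simp: v_closure_def ideal_inv_def mult.commute)

lemma mem_t_closure:
  assumes "frac.subspace A" "a \<in> A" "a \<noteq> 0"
  shows "a \<in> t_closure A"
proof -
  have "v_closure (frac.span {a}) \<subseteq> t_closure A"
    using assms by (intro v_closure_subset_t_closure[of _ a]) simp_all
  moreover have "a \<in> v_closure (frac.span {a})"
    using subset_v_closure frac.span_base by (rule subsetD) simp
  ultimately show ?thesis by (rule subsetD)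
qed

text \<open>If z A lies in D, then z is in J^{-1} for each J inside A, so z J_v lies in D.
  Integrality on a t-closure can therefore be checked before closing.\<close>

lemma ideal_inv_t_closure:
  assumes "z \<in> ideal_inv A"
  shows "z \<in> ideal_inv (t_closure A)"
proof -
  have "z * x \<in> int_elems" if "J \<subseteq> A" "x \<in> v_closure J" for x J
  proof -
    have "z \<in> ideal_inv J" using assms that(1) by (auto simp: ideal_inv_def)
    then have "x * z \<in> int_elems"
      using that(2) by (auto simp: v_closure_def ideal_inv_def[of "ideal_inv J"])
    then show ?thesis by (simp add: mult.commute)
  qed
  then have "z * x \<in> int_elems" if "x \<in> t_closure A" for x
    using that unfolding t_closure_def by (elim UnionE CollectE exE conjE) simp
  then show ?thesis by (simp add: ideal_inv_def)
qed

section \<open>Multiplication of ideals by elements of the quotient field\<close>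

lemma module_hom_mult: "module_hom frac_scale frac_scale ((*) (c :: 'a::idom fract))"
  by unfold_locales (simp_all add: frac_scale_def algebra_simps)

lemma span_scale: "frac.span ((*) c ` S) = (*) c ` frac.span S"
  by (rule module_hom.span_image[OF module_hom_mult])

lemma ideal_inv_scale:
  assumes "c \<noteq> 0"
  shows "ideal_inv ((*) c ` I) = (*) (inverse c) ` ideal_inv I"
proof -
  have "z \<in> ideal_inv ((*) c ` I) \<longleftrightarrow> c * z \<in> ideal_inv I" for z
    by (simp add: ideal_inv_def mult_ac)
  moreover have "z \<in> (*) (inverse c) ` ideal_inv I \<longleftrightarrow> c * z \<in> ideal_inv I" for z
    using assms by (force simp: image_iff field_simps)
  ultimately show ?thesis by blast
qed

lemma v_closure_scale: "c \<noteq> 0 \<Longrightarrow> v_closure ((*) c ` I) = (*) c ` v_closure I"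
  by (simp add: v_closure_def ideal_inv_scale)

lemma fractional_ideal_scale:
  assumes "fractional_ideal I" "c \<noteq> 0"
  shows "fractional_ideal ((*) c ` I)"
proof -
  obtain d where I: "frac.subspace I" "I \<noteq> {0}" and d: "d \<noteq> 0" "\<forall>x\<in>I. to_fract d * x \<in> int_elems"
    using assms(1) unfolding fractional_ideal_def by blast
  obtain p q where pq: "q \<noteq> 0" "c = to_fract p / to_fract q" by (rule fract_denominator)
  have "to_fract (q * d) * (c * x) \<in> int_elems" if "x \<in> I" for x
  proof -
    have "to_fract (q * d) * (c * x) = to_fract p * (to_fract d * x)" using pq by simp
    then show ?thesis using d(2) that by (metis int_elems_mult rangeI)
  qed
  moreover have "frac.subspace ((*) c ` I)"
    using I(1) by (rule module_hom.subspace_image[OF module_hom_mult])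
  moreover have "(*) c ` I \<noteq> {0}"
  proof
    assume *: "(*) c ` I = {0}"
    have "x = 0" if "x \<in> I" for x
      using imageI[OF that, of "(*) c"] assms(2) unfolding * by simp
    then show False using I frac.subspace_0 by blast
  qed
  ultimately show ?thesis
    unfolding fractional_ideal_def using d(1) pq(1) by (auto intro!: exI[of _ "q * d"])
qed

lemma t_closure_scale_subset:
  assumes "c \<noteq> 0"
  shows "(*) c ` t_closure A \<subseteq> t_closure ((*) c ` A)"
proof -
  have "c * x \<in> t_closure ((*) c ` A)"
    if J: "J \<subseteq> A" "fractional_ideal J" "fin_gen J" "x \<in> v_closure J" for J x
  proof -
    have "fin_gen ((*) c ` J)" using J(3) unfolding fin_gen_def by (metis finite_imageI span_scale)
    moreover have "fractional_ideal ((*) c ` J)" using J(2) assms by (rule fractional_ideal_scale)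
    moreover have "c * x \<in> v_closure ((*) c ` J)" using J(4) assms by (simp add: v_closure_scale)
    moreover have "(*) c ` J \<subseteq> (*) c ` A" using J(1) by blast
    ultimately show ?thesis unfolding t_closure_def by blast
  qed
  then show ?thesis unfolding t_closure_def[of A] by blast
qed

lemma t_closure_scale:
  assumes "c \<noteq> 0"
  shows "t_closure ((*) c ` A) = (*) c ` t_closure A"
proof
  have "(*) (inverse c) ` t_closure ((*) c ` A) \<subseteq> t_closure ((*) (inverse c) ` (*) c ` A)"
    using assms by (intro t_closure_scale_subset) simp
  also have "(*) (inverse c) ` (*) c ` A = A" using assms by (simp add: image_image mult.assoc[symmetric])
  finally have "(*) c ` (*) (inverse c) ` t_closure ((*) c ` A) \<subseteq> (*) c ` t_closure A" by blast
  then show "t_closure ((*) c ` A) \<subseteq> (*) c ` t_closure A" using assms by (simp add: image_image mult.assoc[symmetric])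
qed (rule t_closure_scale_subset[OF assms])

section \<open>Products of ideals, and finite type of t-invertible ideals\<close>

lemma ideal_prod_scale: "ideal_prod ((*) c ` I) ((*) d ` J) = (*) (c * d) ` ideal_prod I J"
proof -
  have "{x * y |x y. x \<in> (*) c ` I \<and> y \<in> (*) d ` J} = (*) (c * d) ` {x * y |x y. x \<in> I \<and> y \<in> J}"
  proof (intro equalityI subsetI)
    fix u assume "u \<in> {x * y |x y. x \<in> (*) c ` I \<and> y \<in> (*) d ` J}"
    then obtain x y where "u = (c * x) * (d * y)" "x \<in> I" "y \<in> J" by blast
    moreover have "(c * x) * (d * y) = (c * d) * (x * y)" by (simp only: mult_ac)
    ultimately show "u \<in> (*) (c * d) ` {x * y |x y. x \<in> I \<and> y \<in> J}" by blast
  next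
    fix u assume "u \<in> (*) (c * d) ` {x * y |x y. x \<in> I \<and> y \<in> J}"
    then obtain x y where "u = (c * d) * (x * y)" "x \<in> I" "y \<in> J" by blast
    moreover have "(c * d) * (x * y) = (c * x) * (d * y)" by (simp only: mult_ac)
    ultimately show "u \<in> {x * y |x y. x \<in> (*) c ` I \<and> y \<in> (*) d ` J}" by blast
  qed
  then show ?thesis unfolding ideal_prod_def by (simp add: span_scale)
qed

lemma mem_ideal_prod: "x \<in> I \<Longrightarrow> y \<in> J \<Longrightarrow> x * y \<in> ideal_prod I J"
  unfolding ideal_prod_def by (intro frac.span_base) blast

lemma subspace_ideal_prod: "frac.subspace (ideal_prod I J)"
  unfolding ideal_prod_def by simp

lemma ideal_inv_ideal_prodI:
  assumes "\<And>x y. x \<in> I \<Longrightarrow> y \<in> J \<Longrightarrow> z * (x * y) \<in> int_elems"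
  shows "z \<in> ideal_inv (ideal_prod I J)"
  using assms unfolding ideal_prod_def by (auto simp: ideal_inv_def[of "{x * y |x y. _ x y}"])

lemma ideal_prod_int_elems:
  assumes "frac.subspace I"
  shows "ideal_prod int_elems I = I"
proof
  have "to_fract r * x \<in> I" if "x \<in> I" for r x
    using frac.subspace_scale[OF assms that, of r] by (simp add: frac_scale_def)
  then show "ideal_prod int_elems I \<subseteq> I"
    unfolding ideal_prod_def using assms by (intro frac.span_minimal) auto
  show "I \<subseteq> ideal_prod int_elems I" using mem_ideal_prod[of 1 int_elems _ I] by auto
qed

lemma span_singleton_eq: "frac.span {x} = (*) x ` int_elems"
  by (auto simp: frac.span_singleton frac_scale_def mult.commute)

lemma ideal_prod_finite_left:
  assumes "x \<in> ideal_prod I K"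
  shows "\<exists>S. finite S \<and> S \<subseteq> I \<and> x \<in> ideal_prod S K"
  using assms unfolding ideal_prod_def[of I K]
proof (induction rule: frac.span_induct_alt)
  case base
  then show ?case using frac.subspace_0[OF subspace_ideal_prod] by blast
next
  case (step c u y)
  then obtain s t where st: "u = s * t" "s \<in> I" "t \<in> K" by blast
  obtain S where S: "finite S" "S \<subseteq> I" "y \<in> ideal_prod S K" using step by blast
  have "ideal_prod S K \<subseteq> ideal_prod (insert s S) K"
    unfolding ideal_prod_def by (intro frac.span_mono) blast
  then have "frac_scale c u + y \<in> ideal_prod (insert s S) K"
    using S(3) mem_ideal_prod[of s "insert s S" t K] st
    by (intro frac.subspace_add[OF subspace_ideal_prod] frac.subspace_scale[OF subspace_ideal_prod]) auto
  then show ?case using S st by (intro exI[of _ "insert s S"]) auto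
qed

lemma ideal_prod_finite_left_set:
  assumes "finite L" "L \<subseteq> ideal_prod I K"
  shows "\<exists>S. finite S \<and> S \<subseteq> I \<and> L \<subseteq> ideal_prod S K"
proof -
  obtain f where f: "\<And>x. x \<in> L \<Longrightarrow> finite (f x) \<and> f x \<subseteq> I \<and> x \<in> ideal_prod (f x) K"
    using ideal_prod_finite_left assms(2) by (metis subsetD)
  have "ideal_prod (f x) K \<subseteq> ideal_prod (\<Union> (f ` L)) K" if "x \<in> L" for x
    unfolding ideal_prod_def using that by (intro frac.span_mono) blast
  then show ?thesis using f assms(1) by (intro exI[of _ "\<Union> (f ` L)"]) blast
qed

text \<open>Some finite L inside I I^{-1} has 1 in L_v, and L lies in S I^{-1} for a finite subset S
  of I. If z S is integral and x is in I, then z x maps S I^{-1}, hence L, into D; thus z x lies in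
  D.\<close>

lemma t_invertible_finite_type:
  assumes "t_invertible I"
  obtains S where "finite S" "S \<noteq> {}" "0 \<notin> S" "S \<subseteq> I" "ideal_inv S = ideal_inv I"
proof -
  let ?P = "ideal_prod I (ideal_inv I)"
  have "1 \<in> t_closure ?P" using assms by (simp add: t_invertible_def)
  then obtain L where L: "finite L" "frac.span L \<subseteq> ?P" "1 \<in> v_closure (frac.span L)"
    unfolding t_closure_def fin_gen_def by blast
  have "L \<subseteq> ?P" using frac.span_superset L(2) by (rule subset_trans)
  from ideal_prod_finite_left_set[OF L(1) this]
  obtain S where S: "finite S" "S \<subseteq> I" "L \<subseteq> ideal_prod S (ideal_inv I)"
    by (elim exE conjE)
  have I: "frac.subspace I" "I \<noteq> {0}"
    using assms unfolding t_invertible_def fractional_ideal_def by blast+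
  \<comment> \<open>Removing 0 from S and inserting a nonzero \<open>a\<close> gives a set to which
    \<open>agcd_v_generator_finite\<close> applies, with the same inverse.\<close>
  then obtain a where a: "a \<in> I" "a \<noteq> 0" using frac.subspace_0[OF I(1)] by blast
  have "z \<in> ideal_inv I" if z: "z \<in> ideal_inv S" for z
    unfolding ideal_inv_def
  proof safe
    fix x assume x: "x \<in> I"
    have "(z * x) \<in> ideal_inv (ideal_prod S (ideal_inv I))"
    proof (rule ideal_inv_ideal_prodI)
      fix s t assume "s \<in> S" "t \<in> ideal_inv I"
      then have "(z * s) * (t * x) \<in> int_elems"
        using z x by (intro int_elems_mult[of "z * s"]) (simp_all add: ideal_inv_def)
      then show "z * x * (s * t) \<in> int_elems" by (simp add: mult_ac)
    qed
    then have "z * x \<in> ideal_inv L" using S(3) unfolding ideal_inv_def by blast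
    then show "z * x \<in> int_elems"
      using L(3) by (auto simp: v_closure_def ideal_inv_def[of "ideal_inv L"])
  qed
  moreover have "z \<in> ideal_inv S" if "z \<in> ideal_inv (insert a (S - {0}))" for z
    unfolding ideal_inv_def
  proof safe
    fix s assume "s \<in> S"
    then show "z * s \<in> int_elems"
      using that by (cases "s = 0") (simp_all add: ideal_inv_def)
  qed
  moreover have "ideal_inv I \<subseteq> ideal_inv (insert a (S - {0}))"
    using S(2) a(1) by (auto simp: ideal_inv_def)
  ultimately have "ideal_inv (insert a (S - {0})) = ideal_inv I" by blast
  then show ?thesis using that[of "insert a (S - {0})"] S a by blast
qed

section \<open>Almost GCD domains closed under roots\<close>

text \<open>Closure under roots is the form in which complete integral closure enters the proofs of
  the PVMD property and of torsion.\<close>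

locale root_closed_agcd =
  fixes ty :: "'a::idom itself"
  assumes agcd: "agcd_domain TYPE('a)"
    and root_closed: "\<And>(x :: 'a fract) n. n \<ge> 1 \<Longrightarrow> x ^ n \<in> int_elems \<Longrightarrow> x \<in> int_elems"
begin

text \<open>With (S^n)_v = (d), each s^(n-1) / d lies in I^{-1}. Multiplying by s puts every s^n / d
  in I I^{-1}, and together these elements have v-closure D.\<close>

lemma pvmd: "pvmd TYPE('a)"
  unfolding pvmd_def
proof safe
  fix I :: "'a fract set"
  assume I: "fractional_ideal I" "fin_gen I"
  obtain S0 where S0: "finite S0" "I = frac.span S0" using I(2) unfolding fin_gen_def by blast
  define S where "S = S0 - {0}"
  have span: "I = frac.span S" 
  proof
    have "x \<in> frac.span S" if "x \<in> S0" for x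
      using that frac.span_zero[of S] frac.span_base[of x S] by (cases "x = 0") (simp_all add: S_def)
    then show "I \<subseteq> frac.span S" unfolding S0 by (intro frac.span_minimal) auto
    show "frac.span S \<subseteq> I" unfolding S0 S_def by (intro frac.span_mono) blast
  qed
  have "S \<noteq> {}" using I(1) unfolding span fractional_ideal_def by auto
  moreover have "finite S" "0 \<notin> S" using S0 by (auto simp: S_def)
  ultimately obtain n d where n: "n \<ge> 1" and gen: "v_generator ((\<lambda>x. x ^ n) ` S) d"
    using agcd_v_generator_finite[OF agcd] by blast
  have "d \<noteq> 0" using gen by (simp add: v_generator_def)
  define L where "L = (*) (inverse d) ` (\<lambda>x. x ^ n) ` S"
  have L: "v_generator L 1"
    using v_generator_scale[OF gen, of "inverse d"] \<open>d \<noteq> 0\<close> by (simp add: L_def)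
  have "inverse d * s ^ n \<in> int_elems" if "s \<in> S" for s
    using v_generator_1_subset[OF L] that unfolding L_def by blast
  then have int: "s ^ n / d \<in> int_elems" if "s \<in> S" for s
    using that by (simp only: divide_inverse mult.commute)
  let ?P = "ideal_prod I (ideal_inv I)"
  have inv: "s ^ (n - 1) / d \<in> ideal_inv I" if "s \<in> S" for s
    unfolding span ideal_inv_span
    unfolding ideal_inv_def
  proof (intro CollectI ballI)
    fix t assume "t \<in> S"
    \<comment> \<open>The n-th power splits into factors s^n / d and t^n / d, all integral, so root
      closure applies.\<close>
    have "(s ^ (n - 1) / d * t) ^ n = (s ^ n / d) ^ (n - 1) * (t ^ n / d)"
    proof -
      have "d ^ n = d ^ (n - 1) * d" using n by (cases n) simp_all
      then show ?thesis
        by (simp add: power_mult_distrib power_divide mult.commute flip: power_mult)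
    qed
    also have "\<dots> \<in> int_elems" using int that \<open>t \<in> S\<close> by (intro int_elems_mult int_elems_power)
    finally show "s ^ (n - 1) / d * t \<in> int_elems" using root_closed n by blast
  qed
  have "L \<subseteq> ?P"
  proof -
    have "inverse d * s ^ n \<in> ?P" if "s \<in> S" for s
    proof -
      have "s * (s ^ (n - 1) / d) \<in> ?P"
        using inv[OF that] that by (intro mem_ideal_prod) (auto simp: span frac.span_base)
      moreover have "s * (s ^ (n - 1) / d) = inverse d * s ^ n"
        using n by (cases n) (simp_all add: divide_inverse mult_ac)
      ultimately show ?thesis by simp
    qed
    then show ?thesis by (auto simp: L_def)
  qed
  obtain s where "s \<in> S" "s \<noteq> 0" using \<open>S \<noteq> {}\<close> \<open>0 \<notin> S\<close> by blast
  then have "inverse d * s ^ n \<in> L" "inverse d * s ^ n \<noteq> 0" using \<open>d \<noteq> 0\<close> by (auto simp: L_def)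
  moreover have "finite L" using \<open>finite S\<close> by (simp add: L_def)
  ultimately have "v_closure (frac.span L) \<subseteq> t_closure ?P"
    using \<open>L \<subseteq> ?P\<close> subspace_ideal_prod by (intro v_closure_subset_t_closure)
  then have "int_elems \<subseteq> t_closure ?P"
    using v_closure_v_generator[OF L] by auto
  moreover have "t_closure ?P \<subseteq> int_elems"
  proof -
    have "1 \<in> ideal_inv ?P"
      by (rule ideal_inv_ideal_prodI) (auto simp: ideal_inv_def mult.commute)
    from ideal_inv_t_closure[OF this] show ?thesis by (auto simp: ideal_inv_def)
  qed
  ultimately show "t_invertible I" using I(1) unfolding t_invertible_def by blast
qed

section \<open>Powers of t-invertible ideals and torsion of the class group\<close>

abbreviation t_pow :: "'a fract set \<Rightarrow> nat \<Rightarrow> 'a fract set"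
  where "t_pow I n \<equiv> I [^]\<^bsub>t_inv_ideals TYPE('a)\<^esub> n"

lemma one_t_inv_ideals [simp]: "\<one>\<^bsub>t_inv_ideals TYPE('a)\<^esub> = int_elems"
  by (simp add: t_inv_ideals_def)

lemma t_pow_simps:
  "t_pow I 0 = int_elems" "t_pow I (Suc n) = t_closure (ideal_prod (t_pow I n) I)"
  by (simp_all add: nat_pow_def t_inv_ideals_def)

lemma power_mem_t_pow:
  assumes "s \<in> I" "s \<noteq> 0"
  shows "s ^ n \<in> t_pow I n"
proof (induction n)
  case 0
  show ?case by (simp add: t_pow_simps)
next
  case (Suc n)
  then have "s ^ n * s \<in> ideal_prod (t_pow I n) I" using assms(1) by (rule mem_ideal_prod)
  then show ?case
    unfolding t_pow_simps power_Suc2 using assms(2) by (intro mem_t_closure subspace_ideal_prod) simp_all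
qed

text \<open>An upper bound for a t-power can be tested on n-fold products from \<open>S\<close>:
  equal inverses allow each factor from I to be replaced by factors from S, and t-closure preserves
  the bound. Lists allow repeated factors.\<close>

lemma ideal_inv_t_pow:
  assumes "ideal_inv S = ideal_inv I"
    and "\<And>ss. length ss = n \<Longrightarrow> set ss \<subseteq> S \<Longrightarrow> z * prod_list ss \<in> int_elems"
  shows "z \<in> ideal_inv (t_pow I n)"
  using assms(2)
proof (induction n arbitrary: z)
  case 0
  then have "z \<in> int_elems" by simp
  then show ?case unfolding t_pow_simps ideal_inv_def using int_elems_mult by blast
next
  case (Suc n)
  have *: "z * s \<in> ideal_inv (t_pow I n)" if "s \<in> S" for s
  proof (rule Suc.IH)
    fix ss assume "length ss = n" "set ss \<subseteq> S"
    then show "z * s * prod_list ss \<in> int_elems"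
      using Suc.prems[of "s # ss"] that by (simp add: mult.assoc)
  qed
  have "z \<in> ideal_inv (ideal_prod (t_pow I n) I)"
  proof (rule ideal_inv_ideal_prodI)
    fix x y assume x: "x \<in> t_pow I n" and y: "y \<in> I"
    have "z * x * s \<in> int_elems" if "s \<in> S" for s
    proof -
      have "z * s * x \<in> int_elems" using *[OF that] x by (simp add: ideal_inv_def)
      then show ?thesis by (simp add: mult_ac)
    qed
    then have "z * x \<in> ideal_inv I" unfolding assms(1)[symmetric] by (simp add: ideal_inv_def)
    then show "z * (x * y) \<in> int_elems" using y by (simp add: ideal_inv_def mult.assoc)
  qed
  then show ?case unfolding t_pow_simps by (rule ideal_inv_t_closure)
qed

lemma t_pow_principal:
  assumes "t_invertible I"
  shows "\<exists>n\<ge>1. \<exists>d. d \<noteq> 0 \<and> t_pow I n = (*) d ` int_elems"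
proof -
  obtain S where S: "finite S" "S \<noteq> {}" "0 \<notin> S" "S \<subseteq> I" "ideal_inv S = ideal_inv I"
    using t_invertible_finite_type[OF assms] .
  then obtain n d where n: "n \<ge> 1" and gen: "v_generator ((\<lambda>x. x ^ n) ` S) d"
    using agcd_v_generator_finite[OF agcd] by blast
  have "d \<noteq> 0" using gen by (simp add: v_generator_def)
  have "v_generator ((*) (inverse d) ` (\<lambda>x. x ^ n) ` S) 1"
    using v_generator_scale[OF gen, of "inverse d"] \<open>d \<noteq> 0\<close> by simp
  from v_generator_1_subset[OF this] have "inverse d * s ^ n \<in> int_elems" if "s \<in> S" for s
    using that by blast
  then have int: "s ^ n / d \<in> int_elems" if "s \<in> S" for s
    using that by (simp only: divide_inverse mult.commute)
  have "inverse d \<in> ideal_inv (t_pow I n)"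
  proof (rule ideal_inv_t_pow[OF S(5)])
    fix ss assume ss: "length ss = n" "set ss \<subseteq> S"
    \<comment> \<open>The exponent of \<open>d\<close> is the length rather than n, so that the
      claim can be proved by induction on the list.\<close>
    have "prod_list ss ^ n / d ^ length ss \<in> int_elems" using ss(2)
    proof (induction ss)
      case (Cons s ss)
      then have "(s ^ n / d) * (prod_list ss ^ n / d ^ length ss) \<in> int_elems"
        using int by (intro int_elems_mult) auto
      then show ?case by (simp add: power_mult_distrib)
    qed simp
    then have "(inverse d * prod_list ss) ^ n \<in> int_elems"
      by (simp add: ss(1) power_mult_distrib power_inverse divide_inverse mult.commute)
    then show "inverse d * prod_list ss \<in> int_elems" using root_closed n by blast
  qed
  then have "inverse d * x \<in> int_elems" if "x \<in> t_pow I n" for x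
    using that by (simp add: ideal_inv_def)
  then have "t_pow I n \<subseteq> (*) d ` int_elems"
    using \<open>d \<noteq> 0\<close> by (auto intro!: image_eqI[where x = "inverse d * _"] simp del: image_iff)
  moreover have "(*) d ` int_elems \<subseteq> t_pow I n"
  proof -
    \<comment> \<open>Peeling off one factor exposes the outermost t-closure. The powers s^n already
      lie in the product under it, so their v-closure dD is contained in the t-power.\<close>
    obtain m where m: "n = Suc m" using n by (cases n) auto
    obtain s where s: "s \<in> S" "s \<noteq> 0" using S by blast
    have "(\<lambda>x. x ^ n) ` S \<subseteq> ideal_prod (t_pow I m) I"
    proof safe
      fix s assume "s \<in> S"
      then have "s ^ m * s \<in> ideal_prod (t_pow I m) I"
        using S by (intro mem_ideal_prod power_mem_t_pow) auto
      then show "s ^ n \<in> ideal_prod (t_pow I m) I" by (simp add: m mult.commute)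
    qed
    then have "v_closure (frac.span ((\<lambda>x. x ^ n) ` S)) \<subseteq> t_pow I n"
      unfolding m t_pow_simps using S(1) s
      by (intro v_closure_subset_t_closure[of _ "s ^ Suc m"] subspace_ideal_prod) auto
    moreover have "d * r \<in> v_closure (frac.span ((\<lambda>x. x ^ n) ` S))" if "r \<in> int_elems" for r
      using v_closure_v_generator[OF gen] that \<open>d \<noteq> 0\<close> by simp
    ultimately show ?thesis by blast
  qed
  ultimately show ?thesis using n \<open>d \<noteq> 0\<close> by blast
qed

text \<open>The coset of \<open>I\<close> is \<open>{c I | c \<noteq> 0}\<close>, so its powers can be computed without knowing that
  the \<open>t\<close>-invertible \<open>t\<close>-ideals form a group.\<close>

lemma t_class_pow:
  assumes "t_ideal I"
  shows "(principal_fractional_ideals TYPE('a) #>\<^bsub>t_inv_ideals TYPE('a)\<^esub> I)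
      [^]\<^bsub>t_class_group TYPE('a)\<^esub> n = {(*) c ` t_pow I n |c. c \<noteq> 0}"
proof (induction n)
  case 0
  show ?case
    by (simp add: nat_pow_def t_class_group_def principal_fractional_ideals_def t_inv_ideals_def
        span_singleton_eq)
next
  case (Suc n)
  have t: "frac.subspace I" "t_closure I = I"
    using assms by (auto simp: t_ideal_def fractional_ideal_def)
  have scale: "t_closure (ideal_prod ((*) c ` A) ((*) d ` B)) = (*) (c * d) ` t_closure (ideal_prod A B)"
    if "c \<noteq> 0" "d \<noteq> 0" for c d :: "'a fract" and A B
    using that by (simp add: ideal_prod_scale t_closure_scale)
  have "t_closure (ideal_prod ((*) c ` int_elems) I) = (*) c ` I" if "c \<noteq> 0" for c :: "'a fract"
    using scale[OF that, of 1 int_elems I] by (simp add: ideal_prod_int_elems t)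
  \<comment> \<open>As I is a t-ideal, (cD I)_t is just c I.\<close>
  then have coset: "principal_fractional_ideals TYPE('a) #>\<^bsub>t_inv_ideals TYPE('a)\<^esub> I
      = {(*) c ` I |c. c \<noteq> 0}"
    by (auto simp: r_coset_def principal_fractional_ideals_def t_inv_ideals_def span_singleton_eq)
  have "{(*) c ` P |c. c \<noteq> 0} <#>\<^bsub>t_inv_ideals TYPE('a)\<^esub> {(*) c ` I |c. c \<noteq> 0}
      = {t_closure (ideal_prod ((*) c ` P) ((*) d ` I)) |c d. c \<noteq> 0 \<and> d \<noteq> 0}" for P
    unfolding set_mult_def t_inv_ideals_def by auto
  then have "{(*) c ` t_pow I n |c. c \<noteq> 0} <#>\<^bsub>t_inv_ideals TYPE('a)\<^esub> {(*) c ` I |c. c \<noteq> 0}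
      = {(*) (c * d) ` t_pow I (Suc n) |c d. c \<noteq> 0 \<and> d \<noteq> 0}"
    unfolding t_pow_simps by (simp add: scale cong: rev_conj_cong)
  also have "\<dots> = {(*) c ` t_pow I (Suc n) |c. c \<noteq> 0}"
  proof safe
    fix c d :: "'a fract" assume "c \<noteq> 0" "d \<noteq> 0"
    then show "\<exists>c'. (*) (c * d) ` t_pow I (Suc n) = (*) c' ` t_pow I (Suc n) \<and> c' \<noteq> 0"
      by (intro exI[of _ "c * d"]) simp
  next
    fix c :: "'a fract" assume "c \<noteq> 0"
    then show "\<exists>c' d. (*) c ` t_pow I (Suc n) = (*) (c' * d) ` t_pow I (Suc n) \<and> c' \<noteq> 0 \<and> d \<noteq> 0"
      by (intro exI[of _ c] exI[of _ 1]) simp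
  qed
  finally show ?case
    using Suc.IH by (simp add: nat_pow_def t_class_group_def coset)
qed

lemma torsion_t_class_group: "torsion_group (t_class_group TYPE('a))"
  unfolding torsion_group_def
proof
  fix X assume "X \<in> carrier (t_class_group TYPE('a))"
  then obtain I where I: "t_ideal I" "t_invertible I"
    and X: "X = principal_fractional_ideals TYPE('a) #>\<^bsub>t_inv_ideals TYPE('a)\<^esub> I"
    by (auto simp: t_class_group_def carrier_FactGroup t_inv_ideals_def)
  obtain n d where n: "n \<ge> 1" and d: "d \<noteq> 0" "t_pow I n = (*) d ` int_elems"
    using t_pow_principal[OF I(2)] by blast
  \<comment> \<open>The nonzero multiples of dD are exactly the nonzero principal fractional ideals,
    that is, the identity coset.\<close>
  have "{(*) c ` t_pow I n |c. c \<noteq> 0} = {(*) c ` int_elems |c :: 'a fract. c \<noteq> 0}" (is "?A = ?B")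
  proof
    show "?A \<subseteq> ?B" using d by (force simp: image_image mult.assoc[symmetric])
    show "?B \<subseteq> ?A"
    proof safe
      fix c :: "'a fract" assume "c \<noteq> 0"
      then show "\<exists>c'. (*) c ` int_elems = (*) c' ` t_pow I n \<and> c' \<noteq> 0"
        using d by (intro exI[of _ "c / d"]) (simp add: image_image mult.assoc[symmetric])
    qed
  qed
  also have "\<dots> = \<one>\<^bsub>t_class_group TYPE('a)\<^esub>"
    by (simp add: t_class_group_def principal_fractional_ideals_def span_singleton_eq)
  finally show "\<exists>n::nat. n \<ge> 1 \<and> X [^]\<^bsub>t_class_group TYPE('a)\<^esub> n = \<one>\<^bsub>t_class_group TYPE('a)\<^esub>"
    unfolding X using n t_class_pow[OF I(1), of n] by (intro exI[of _ n]) simp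
qed

end

theorem corollary2p14:
  assumes "agcd_domain TYPE('a::idom)"
  shows "(integrally_closed TYPE('a fps) \<longleftrightarrow>
            completely_integrally_closed TYPE('a) \<and> pvmd TYPE('a) \<and>
            torsion_group (t_class_group TYPE('a))) \<and>
         (completely_integrally_closed TYPE('a fps) \<longleftrightarrow>
            completely_integrally_closed TYPE('a) \<and> pvmd TYPE('a) \<and>
            torsion_group (t_class_group TYPE('a)))"
proof -
  have "pvmd TYPE('a) \<and> torsion_group (t_class_group TYPE('a))"
    if cic: "completely_integrally_closed TYPE('a)"
  proof -
    note ic = completely_integrally_closed_imp_integrally_closed[OF cic]
    interpret root_closed_agcd "TYPE('a)"
      using assms integrally_closed_root[OF ic] by unfold_locales
    show ?thesis using pvmd torsion_t_class_group by blast
  qed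
  moreover have "completely_integrally_closed TYPE('a)" if "integrally_closed TYPE('a fps)"
    using integrally_closed_fps_imp_completely_integrally_closed[OF assms that] .
  \<comment> \<open>The implications form a cycle: D completely integrally closed, then D[[X]]
    completely integrally closed, then D[[X]] integrally closed, then D completely integrally
    closed.\<close>
  ultimately show ?thesis
    using completely_integrally_closed_fps completely_integrally_closed_imp_integrally_closed
    by blast
qed

end
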